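(* Let $N \geq 3$ and let $$\tilde{I}_2 f(x) := \frac{\Gamma(\frac{N}{2})}{2\pi^{\frac{N}{2}}(N-2)} \int_{\mathbb{R}^N} \left[\frac{1}{|y-x|^{N-2}} - \frac{1}{|y|^{N-2}}\right] f(y) \, dy, \qquad x\in\mathbb{R}^N.$$ For any $1 \leq q < N$, there exists a constant $C = C(q, N)$ such that $$|\tilde{I}_2 f(x) - \tilde{I}_2 f(z)| \leq C|x-z|\left(\left|\ln|x-z|\right| + 1\right)^{\frac{1}{N'}} \left(\|f\|_{L^q(\mathbb{R}^N)} + \|f\|_{L^N(\mathbb{R}^N)}\right)$$ for all $x,z\in\mathbb{R}^N$ and all $f \in L^N(\mathbb{R}^N) \cap L^q(\mathbb{R}^N)$.
   Context: $N' = \frac{N}{N-1}$ is the Hölder conjugate exponent of $N$, $\Gamma$ is the Gamma function, and $|\cdot|$ is the Euclidean norm. When $x=z$ the right-hand side is interpreted as $0$. *)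

theory Defs
  imports "HOL-Analysis.Analysis"
begin

text \<open>
  Functions are honest functions measurable with respect to the completed Lebesgue
  measure; nothing below depends on their values on a null set.
\<close>

definition Lp_space :: "real \<Rightarrow> (real ^ 'n \<Rightarrow> real) set" where
  "Lp_space p = {f. f \<in> borel_measurable lebesgue \<and>
     integrable lebesgue (\<lambda>x. \<bar>f x\<bar> powr p)}"

definition Lp_norm :: "real \<Rightarrow> (real ^ 'n \<Rightarrow> real) \<Rightarrow> real" where
  "Lp_norm p f = (LINT x|lebesgue. \<bar>f x\<bar> powr p) powr (1 / p)"

definition hoelder_conj :: "real \<Rightarrow> real" where
  "hoelder_conj p = p / (p - 1)"

text \<open>
  The renormalised Riesz potential of order 2, for dimension at least 3.  The kernel takes
  junk values (division by zero) only at the two points \<open>y = x\<close> and \<open>y = 0\<close>.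
\<close>

definition I2_tilde :: "(real ^ 'n \<Rightarrow> real) \<Rightarrow> real ^ 'n \<Rightarrow> real" where
  "I2_tilde f x =
     Gamma (real CARD('n) / 2) / (2 * pi powr (real CARD('n) / 2) * (real CARD('n) - 2)) *
     (LINT y|lebesgue.
        (1 / norm (y - x) ^ (CARD('n) - 2) - 1 / norm y ^ (CARD('n) - 2)) * f y)"

end

theory Submission
  imports Defs
begin

text \<open>
  Write \<open>N\<close> for the dimension, \<open>N' = N / (N - 1)\<close>, \<open>k(u) = 1 / |u|^(N - 2)\<close> and \<open>h = |x - z|\<close>.
  Subtracting the two potentials cancels the normalising term \<open>k(y)\<close>, so up to a constant the
  difference is the integral of \<open>(k(y - x) - k(y - z)) f(y)\<close>.  Three ranges of \<open>y\<close> behave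
  differently.

  Where \<open>|y - x| \<le> 2h\<close>, nothing is gained from the subtraction: both kernels live on balls of radius
  at most \<open>3h\<close>, and Hoelder's inequality with exponents \<open>N, N'\<close> applies because \<open>k\<close> is locally in
  \<open>L^N'\<close>; its norm on a ball of radius \<open>\<rho>\<close> scales exactly like \<open>\<rho>\<close>
  (\<open>inner_kernel_bound\<close>).

  Where \<open>|y - x| > 2h\<close>, the mean value estimate \<open>inverse_power_diff_le\<close> replaces the difference by
  a multiple of \<open>h / |y - x|^(N - 1)\<close>.  This kernel is critical for \<open>L^N'\<close>: its \<open>N'\<close>-th power is
  \<open>|y - x|^(-N)\<close>, whose integral over an annulus is the logarithm of the ratio of the radii.  On the
  annulus \<open>2h \<le> |y - x| \<le> 1\<close> this yields the factor \<open>|ln h|^(1/N')\<close>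
  (\<open>annular_kernel_bound\<close>).  Beyond radius \<open>1\<close> the logarithm would diverge, and the \<open>L^q\<close> norm takes
  over: \<open>|y - x|^(1 - N)\<close> is in \<open>L^q'\<close> at infinity precisely when \<open>q < N\<close>
  (\<open>outer_kernel_bound\<close>).

  The same bounds show that every integrand is absolutely integrable, which is what permits
  subtracting the two integrals in the first place.
\<close>

section \<open>Integration of radial functions\<close>

text \<open>
  Polar coordinates, reduced to what radial integrands need.  Both measures are determined by their
  values on the half-lines \<open>{..a}\<close>, where the left side is the volume of a ball and the right side
  is the integral of the derivative of that volume with respect to the radius.
\<close>

lemma distr_norm_lborel:
  "distr (lborel :: 'a::euclidean_space measure) borel norm =
     density lborel (\<lambda>r. ennreal (real DIM('a) * unit_ball_vol (real DIM('a)) * r ^ (DIM('a) - 1))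
                       * indicator {0..} r)"
    (is "?D = density lborel ?w")
proof -
  let ?n = "DIM('a)"
  let ?v = "unit_ball_vol (real ?n)"
  have v: "?v \<ge> 0" by simp
  have w [measurable]: "?w \<in> borel_measurable lborel" by measurable
  have D: "emeasure ?D {..a} = ennreal (?v * a ^ ?n)" if "a \<ge> 0" for a
  proof -
    have "emeasure ?D {..a} = emeasure lborel (cball (0::'a) a)"
      by (subst emeasure_distr) (auto intro!: arg_cong2[where f = emeasure])
    then show ?thesis using that emeasure_cball[of a "0::'a"] by simp
  qed
  have D_neg: "emeasure ?D {..a} = 0" if "a < 0" for a
  proof -
    have "norm -` {..a} \<inter> space (lborel :: 'a measure) = {}"
      using that by (auto dest: order.trans[OF norm_ge_zero])
    then show ?thesis by (simp add: emeasure_distr)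
  qed
  have W: "emeasure (density lborel ?w) {..a} = ennreal (?v * a ^ ?n)" if "a \<ge> 0" for a
  proof -
    have "((\<lambda>r. real ?n * ?v * r ^ (?n - 1)) has_integral (?v * a ^ ?n - ?v * 0 ^ ?n)) {0..a}"
      using that by (intro fundamental_theorem_of_calculus)
        (auto intro!: derivative_eq_intros simp: has_real_derivative_iff_has_vector_derivative[symmetric])
    then have "((\<lambda>r. real ?n * ?v * r ^ (?n - 1)) has_integral (?v * a ^ ?n)) {0..a}"
      by (simp add: power_0_left)
    then have "(\<integral>\<^sup>+r. ennreal (real ?n * ?v * r ^ (?n - 1)) * indicator {0..a} r \<partial>lborel)
                 = ennreal (?v * a ^ ?n)"
      by (intro nn_integral_has_integral_lebesgue') auto
    moreover have "emeasure (density lborel ?w) {..a} =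
        (\<integral>\<^sup>+r. ennreal (real ?n * ?v * r ^ (?n - 1)) * indicator {0..a} r \<partial>lborel)"
      by (subst emeasure_density) (auto intro!: nn_integral_cong simp: indicator_def)
    ultimately show ?thesis by simp
  qed
  have W_neg: "emeasure (density lborel ?w) {..a} = 0" if "a < 0" for a
  proof -
    have "emeasure (density lborel ?w) {..a} = (\<integral>\<^sup>+r. 0 \<partial>(lborel :: real measure))"
      using that by (subst emeasure_density)
        (auto intro!: nn_integral_cong simp: indicator_def simp del: nn_integral_const)
    then show ?thesis by simp
  qed
  have U: "(\<Union>i. {..real i}) = UNIV"
    by (auto intro: real_arch_simple)
  have B: "sets borel = sigma_sets UNIV (range (atMost :: real \<Rightarrow> real set))"
    by (subst borel_eq_atMost) (auto simp: sets_measure_of)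
  show ?thesis
  proof (rule measure_eqI_generator_eq[where E = "range atMost" and \<Omega> = UNIV
        and A = "\<lambda>i. {..real i}"])
    show "Int_stable (range (atMost :: real \<Rightarrow> real set))"
      by (auto simp: Int_stable_def)
    fix X assume "X \<in> range (atMost :: real \<Rightarrow> real set)"
    then obtain a where "X = {..a}" by auto
    then show "emeasure ?D X = emeasure (density lborel ?w) X"
      using D D_neg W W_neg by (cases "a \<ge> 0") auto
  next
    fix i show "emeasure ?D {..real i} \<noteq> \<infinity>" using D[of "real i"] by simp
  qed (use U B in auto)
qed

lemma nn_integral_radial:
  fixes g :: "real \<Rightarrow> ennreal" and c :: "'a::euclidean_space"
  assumes [measurable]: "g \<in> borel_measurable borel"
  shows "(\<integral>\<^sup>+y. g (norm (y - c)) \<partial>lborel) =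
     (\<integral>\<^sup>+r. ennreal (real DIM('a) * unit_ball_vol (real DIM('a)) * r ^ (DIM('a) - 1))
            * indicator {0..} r * g r \<partial>lborel)"
proof -
  have "(\<integral>\<^sup>+y. g (norm (y - c)) \<partial>lborel) = (\<integral>\<^sup>+y. g (norm (y - c)) \<partial>distr lborel borel ((+) c))"
    by (simp add: lborel_distr_plus)
  also have "\<dots> = (\<integral>\<^sup>+y. g (norm (y :: 'a)) \<partial>lborel)"
    by (subst nn_integral_distr) auto
  also have "\<dots> = (\<integral>\<^sup>+r. g r \<partial>distr (lborel :: 'a measure) borel norm)"
    by (subst nn_integral_distr) auto
  finally show ?thesis
    by (simp add: distr_norm_lborel nn_integral_density)
qed

section \<open>Hoelder's inequality against a radial kernel\<close>

text \<open>
  Young's inequality applied to \<open>f\<close> and \<open>g\<close> after scaling both to norm at most one.  A vanishing bound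
  leaves nothing to scale by, but then one factor is zero almost everywhere.
\<close>

lemma nn_integral_Hoelder:
  fixes f g :: "'a \<Rightarrow> real"
  assumes pq: "p > 1" "q > 1" "1 / p + 1 / q = 1"
    and [measurable]: "f \<in> borel_measurable M" "g \<in> borel_measurable M"
    and A: "(\<integral>\<^sup>+x. ennreal (\<bar>f x\<bar> powr p) \<partial>M) \<le> ennreal A" "0 \<le> A"
    and B: "(\<integral>\<^sup>+x. ennreal (\<bar>g x\<bar> powr q) \<partial>M) \<le> ennreal B" "0 \<le> B"
  shows "(\<integral>\<^sup>+x. ennreal (\<bar>f x\<bar> * \<bar>g x\<bar>) \<partial>M) \<le> ennreal (A powr (1 / p) * B powr (1 / q))"
proof -
  have null: "(\<integral>\<^sup>+x. ennreal (\<bar>f x\<bar> * \<bar>g x\<bar>) \<partial>M) = 0"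
    if "h = f \<or> h = g" "(\<integral>\<^sup>+x. ennreal (\<bar>h x\<bar> powr s) \<partial>M) \<le> 0" for h s
  proof -
    have [measurable]: "h \<in> borel_measurable M" using that by auto
    have "AE x in M. ennreal (\<bar>h x\<bar> powr s) = 0"
      using that by (subst nn_integral_0_iff_AE[symmetric]) auto
    then have "AE x in M. h x = 0" by eventually_elim (auto simp: ennreal_eq_0_iff)
    then have "AE x in M. ennreal (\<bar>f x\<bar> * \<bar>g x\<bar>) = 0"
      by eventually_elim (use that in auto)
    then show ?thesis by (subst nn_integral_0_iff_AE) auto
  qed
  show ?thesis
  proof (cases "A = 0 \<or> B = 0")
    case True
    then show ?thesis using null[of f p] null[of g q] A B by auto
  next
    case False
    define a where "a = A powr (1 / p)"
    define b where "b = B powr (1 / q)"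
    have pos: "a > 0" "b > 0" "A > 0" "B > 0" using False A B by (auto simp: a_def b_def)
    have ap: "a powr p = A" and bq: "b powr q = B" using pos pq by (simp_all add: a_def b_def powr_powr)
    have pt: "\<bar>f x\<bar> * \<bar>g x\<bar> \<le> a * b / (p * A) * \<bar>f x\<bar> powr p + a * b / (q * B) * \<bar>g x\<bar> powr q" for x
    proof -
      have "(\<bar>f x\<bar> / a) * (\<bar>g x\<bar> / b) \<le> (\<bar>f x\<bar> / a) powr p / p + (\<bar>g x\<bar> / b) powr q / q"
        using pos pq by (intro Youngs_inequality) auto
      also have "\<dots> = \<bar>f x\<bar> powr p / (p * A) + \<bar>g x\<bar> powr q / (q * B)"
        using pos by (simp add: powr_divide ap bq mult.commute)
      finally have "(a * b) * ((\<bar>f x\<bar> / a) * (\<bar>g x\<bar> / b)) \<le>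
          (a * b) * (\<bar>f x\<bar> powr p / (p * A) + \<bar>g x\<bar> powr q / (q * B))"
        using pos by (intro mult_left_mono) auto
      then show ?thesis using pos by (simp add: field_simps)
    qed
    have "(\<integral>\<^sup>+x. ennreal (\<bar>f x\<bar> * \<bar>g x\<bar>) \<partial>M) \<le>
       (\<integral>\<^sup>+x. ennreal (a * b / (p * A)) * ennreal (\<bar>f x\<bar> powr p)
             + ennreal (a * b / (q * B)) * ennreal (\<bar>g x\<bar> powr q) \<partial>M)"
      using pos pq pt by (intro nn_integral_mono)
        (auto simp: ennreal_mult'[symmetric] ennreal_plus[symmetric] simp del: ennreal_plus intro!: ennreal_leI)
    also have "\<dots> = ennreal (a * b / (p * A)) * (\<integral>\<^sup>+x. ennreal (\<bar>f x\<bar> powr p) \<partial>M)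
             + ennreal (a * b / (q * B)) * (\<integral>\<^sup>+x. ennreal (\<bar>g x\<bar> powr q) \<partial>M)"
      by (simp add: nn_integral_add nn_integral_cmult)
    also have "\<dots> \<le> ennreal (a * b / (p * A)) * ennreal A + ennreal (a * b / (q * B)) * ennreal B"
      using A B by (intro add_mono mult_left_mono) auto
    also have "\<dots> = ennreal (a * b / (p * A) * A + a * b / (q * B) * B)"
      using pos pq by (simp add: ennreal_mult'[symmetric] ennreal_plus[symmetric] del: ennreal_plus)
    also have "a * b / (p * A) * A + a * b / (q * B) * B = a * b * (1 / p + 1 / q)"
      using pos by (simp add: field_simps)
    finally show ?thesis using pq by (simp add: a_def b_def)
  qed
qed

text \<open>
  The only information about the kernel that enters is one integral over radii: the exponent collects
  \<open>N - 1\<close> from the surface measure and \<open>- m q\<close> from the \<open>q\<close>-th power of \<open>1 / r ^ m\<close>.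
\<close>

lemma nn_integral_radial_kernel_Hoelder:
  fixes f :: "real ^ 'n::finite \<Rightarrow> real" and c :: "real ^ 'n"
  assumes n: "CARD('n) \<ge> 2" and pq: "p > 1" "q > 1" "1 / p + 1 / q = 1"
    and f: "f \<in> Lp_space p"
    and S [measurable]: "S \<in> sets borel" and S0: "S \<subseteq> {0..}"
    and K: "((\<lambda>r. r powr (real CARD('n) - 1 - real m * q)) has_integral K) S"
  shows "(\<integral>\<^sup>+y. ennreal (\<bar>f y\<bar> * (indicator S (norm (y - c)) / norm (y - c) ^ m)) \<partial>lebesgue)
     \<le> ennreal ((real CARD('n) * unit_ball_vol (real CARD('n)) * K) powr (1 / q) * Lp_norm p f)"
proof -
  let ?k = "real CARD('n) * unit_ball_vol (real CARD('n))"
  let ?g = "\<lambda>y. indicator S (norm (y - c)) / norm (y - c) ^ m :: real"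
  have K0: "K \<ge> 0" using K by (rule has_integral_nonneg) auto
  have g: "?g \<in> borel_measurable lborel" by measurable
  then have gm [measurable]: "?g \<in> borel_measurable lebesgue" by (rule measurable_completion)
  have fm [measurable]: "f \<in> borel_measurable lebesgue"
    and fi: "integrable lebesgue (\<lambda>x. \<bar>f x\<bar> powr p)" using f by (auto simp: Lp_space_def)
  have F: "(\<integral>\<^sup>+y. ennreal (\<bar>f y\<bar> powr p) \<partial>lebesgue) = ennreal (LINT y|lebesgue. \<bar>f y\<bar> powr p)"
    using fi by (intro nn_integral_eq_integral) auto
  \<comment> \<open>At \<open>r = 0\<close> division by zero is harmless: both sides vanish, the left one because of the factor
      \<open>r ^ (N - 1)\<close> with \<open>N \<ge> 2\<close>, the right one because zero to any real power is zero.\<close>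
  have pw: "ennreal (?k * r ^ (CARD('n) - 1)) * indicator {0..} r
              * ennreal (\<bar>indicator S r / r ^ m\<bar> powr q)
            = ennreal ?k * (ennreal (r powr (real CARD('n) - 1 - real m * q)) * indicator S r)" for r :: real
  proof (cases "r > 0")
    case True
    have "(1 / r ^ m) powr q = r powr (- (real m * q))"
      using True by (simp add: powr_divide powr_powr powr_minus_divide flip: powr_realpow)
    moreover have "r ^ (CARD('n) - 1) = r powr (real CARD('n) - 1)"
      using True n by (subst powr_realpow[symmetric]) (auto simp: of_nat_diff)
    ultimately show ?thesis using True
      by (auto simp: indicator_def ennreal_mult'[symmetric] powr_add[symmetric])
  next
    case False
    then show ?thesis using S0 n by (cases "r = 0") (auto simp: indicator_def)
  qed
  have "(\<integral>\<^sup>+y. ennreal (\<bar>?g y\<bar> powr q) \<partial>lebesgue) = (\<integral>\<^sup>+y. ennreal (\<bar>?g y\<bar> powr q) \<partial>lborel)"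
    by (rule nn_integral_completion)
  also have "\<dots> = (\<integral>\<^sup>+r. ennreal (?k * r ^ (CARD('n) - 1)) * indicator {0..} r
              * ennreal (\<bar>indicator S r / r ^ m\<bar> powr q) \<partial>lborel)"
    using nn_integral_radial[of "\<lambda>r. ennreal (\<bar>indicator S r / r ^ m\<bar> powr q)" c] by simp
  also have "\<dots> = ennreal ?k * (\<integral>\<^sup>+r. ennreal (r powr (real CARD('n) - 1 - real m * q)) * indicator S r \<partial>lborel)"
    by (simp only: pw) (auto simp: nn_integral_cmult)
  also have "\<dots> = ennreal ?k * ennreal K"
    using K by (subst nn_integral_has_integral_lebesgue') auto
  also have "\<dots> = ennreal (?k * K)"
    using K0 by (simp add: ennreal_mult'[symmetric])
  finally have G: "(\<integral>\<^sup>+y. ennreal (\<bar>?g y\<bar> powr q) \<partial>lebesgue) = ennreal (?k * K)" .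
  have "(\<integral>\<^sup>+y. ennreal (\<bar>f y\<bar> * \<bar>?g y\<bar>) \<partial>lebesgue) \<le>
      ennreal ((LINT y|lebesgue. \<bar>f y\<bar> powr p) powr (1 / p) * (?k * K) powr (1 / q))"
    using F G K0 by (intro nn_integral_Hoelder[OF pq]) auto
  then show ?thesis by (simp add: Lp_norm_def mult.commute abs_mult)
qed

section \<open>The three ranges of the kernel\<close>

text \<open>
  The radial exponent \<open>N - 1 - (N - 2) N'\<close> equals \<open>N' - 1\<close>, so the \<open>N'\<close>-th power of the norm of the
  kernel on the ball is proportional to \<open>\<rho> powr N'\<close>.
\<close>

lemma inner_kernel_bound:
  assumes n: "CARD('n::finite) \<ge> 3"
  obtains C where "C \<ge> 0"
    "\<And>\<rho> (c :: real ^ 'n) f. \<rho> \<ge> 0 \<Longrightarrow> f \<in> Lp_space (real CARD('n)) \<Longrightarrow>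
     (\<integral>\<^sup>+y. ennreal (\<bar>f y\<bar> * (indicator {0..\<rho>} (norm (y - c)) / norm (y - c) ^ (CARD('n) - 2))) \<partial>lebesgue)
       \<le> ennreal (C * \<rho> * Lp_norm (real CARD('n)) f)"
proof -
  define N where "N = real CARD('n)"
  define N' where "N' = N / (N - 1)"
  define k where "k = N * unit_ball_vol N"
  have N: "N \<ge> 3" using n by (simp add: N_def)
  have N': "N' > 1" "1 / N + 1 / N' = 1" using N by (simp_all add: N'_def field_simps)
  have k: "k \<ge> 0" using N by (simp add: k_def)
  have e: "N - 1 - real (CARD('n) - 2) * N' = N' - 1"
    using n N by (simp add: N'_def N_def of_nat_diff field_simps)
  show ?thesis
  proof (rule that[of "(k / N') powr (1 / N')"])
    fix \<rho> :: real and c :: "real ^ 'n" and f :: "real ^ 'n \<Rightarrow> real"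
    assume \<rho>: "\<rho> \<ge> 0" and f: "f \<in> Lp_space (real CARD('n))"
    have K: "((\<lambda>r. r powr (N - 1 - real (CARD('n) - 2) * N')) has_integral (\<rho> powr N' / N')) {0..\<rho>}"
      using has_integral_powr_from_0[of "N' - 1" \<rho>] N' \<rho> unfolding e by simp
    have "(\<integral>\<^sup>+y. ennreal (\<bar>f y\<bar> * (indicator {0..\<rho>} (norm (y - c)) / norm (y - c) ^ (CARD('n) - 2))) \<partial>lebesgue)
       \<le> ennreal ((k * (\<rho> powr N' / N')) powr (1 / N') * Lp_norm N f)"
      unfolding k_def N_def
      by (rule nn_integral_radial_kernel_Hoelder[OF _ _ _ _ f])
         (use n N N' K in \<open>auto simp: N_def\<close>)
    also have "(k * (\<rho> powr N' / N')) powr (1 / N') = ((k / N') * \<rho> powr N') powr (1 / N')"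
      by simp
    also have "\<dots> = (k / N') powr (1 / N') * \<rho>"
      using k N' \<rho> by (subst powr_mult) (auto simp: powr_powr)
    finally show "(\<integral>\<^sup>+y. ennreal (\<bar>f y\<bar> * (indicator {0..\<rho>} (norm (y - c)) / norm (y - c) ^ (CARD('n) - 2))) \<partial>lebesgue)
       \<le> ennreal ((k / N') powr (1 / N') * \<rho> * Lp_norm (real CARD('n)) f)"
      by (simp add: N_def)
  qed simp
qed

text \<open>
  Here the radial exponent \<open>N - 1 - (N - 1) N'\<close> is exactly \<open>- 1\<close>; this is where the logarithm and its
  power \<open>1 / N'\<close> come from.
\<close>

lemma annular_kernel_bound:
  assumes n: "CARD('n::finite) \<ge> 3"
  obtains C where "C \<ge> 0"
    "\<And>a b (c :: real ^ 'n) f. a > 0 \<Longrightarrow> a \<le> b \<Longrightarrow> f \<in> Lp_space (real CARD('n)) \<Longrightarrow>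
     (\<integral>\<^sup>+y. ennreal (\<bar>f y\<bar> * (indicator {a..b} (norm (y - c)) / norm (y - c) ^ (CARD('n) - 1))) \<partial>lebesgue)
       \<le> ennreal (C * ln (b / a) powr (1 / hoelder_conj (real CARD('n))) * Lp_norm (real CARD('n)) f)"
proof -
  define N where "N = real CARD('n)"
  define N' where "N' = N / (N - 1)"
  define k where "k = N * unit_ball_vol N"
  have N: "N \<ge> 3" using n by (simp add: N_def)
  have N': "N' > 1" "1 / N + 1 / N' = 1" using N by (simp_all add: N'_def field_simps)
  have k: "k \<ge> 0" using N by (simp add: k_def)
  have e: "N - 1 - real (CARD('n) - 1) * N' = - 1"
    using n N by (simp add: N'_def N_def of_nat_diff field_simps)
  show ?thesis
  proof (rule that[of "k powr (1 / N')"])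
    fix a b :: real and c :: "real ^ 'n" and f :: "real ^ 'n \<Rightarrow> real"
    assume ab: "0 < a" "a \<le> b" and f: "f \<in> Lp_space (real CARD('n))"
    have "((\<lambda>r. 1 / r) has_integral (ln b - ln a)) {a..b}"
      using ab by (intro fundamental_theorem_of_calculus)
        (auto intro!: derivative_eq_intros simp: has_real_derivative_iff_has_vector_derivative[symmetric])
    also have "ln b - ln a = ln (b / a)" using ab by (simp add: ln_div)
    finally have K: "((\<lambda>r. r powr (N - 1 - real (CARD('n) - 1) * N')) has_integral ln (b / a)) {a..b}"
      unfolding e by (rule has_integral_eq[rotated]) (use ab in \<open>auto simp: powr_minus_divide\<close>)
    have "(\<integral>\<^sup>+y. ennreal (\<bar>f y\<bar> * (indicator {a..b} (norm (y - c)) / norm (y - c) ^ (CARD('n) - 1))) \<partial>lebesgue)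
       \<le> ennreal ((k * ln (b / a)) powr (1 / N') * Lp_norm N f)"
      unfolding k_def N_def
      by (rule nn_integral_radial_kernel_Hoelder[OF _ _ _ _ f])
         (use n N N' K ab in \<open>auto simp: N_def\<close>)
    also have "(k * ln (b / a)) powr (1 / N') = k powr (1 / N') * ln (b / a) powr (1 / N')"
      using k ab by (subst powr_mult) auto
    finally show "(\<integral>\<^sup>+y. ennreal (\<bar>f y\<bar> * (indicator {a..b} (norm (y - c)) / norm (y - c) ^ (CARD('n) - 1))) \<partial>lebesgue)
       \<le> ennreal (k powr (1 / N') * ln (b / a) powr (1 / hoelder_conj (real CARD('n))) * Lp_norm (real CARD('n)) f)"
      by (simp add: N_def N'_def hoelder_conj_def)
  qed simp
qed

text \<open>
  For \<open>q > 1\<close> the radial exponent with the conjugate \<open>q'\<close> is \<open>- (N - 1) / (q - 1)\<close>, which is below \<open>- 1\<close>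
  exactly when \<open>q < N\<close>.  For \<open>q = 1\<close> the conjugate exponent is infinite, and the kernel is simply
  bounded by \<open>1\<close>.
\<close>

lemma outer_kernel_bound:
  assumes n: "CARD('n::finite) \<ge> 3" and q: "1 \<le> q" "q < real CARD('n)"
  obtains C where "C \<ge> 0"
    "\<And>(c :: real ^ 'n) f. f \<in> Lp_space q \<Longrightarrow>
     (\<integral>\<^sup>+y. ennreal (\<bar>f y\<bar> * (indicator {1..} (norm (y - c)) / norm (y - c) ^ (CARD('n) - 1))) \<partial>lebesgue)
       \<le> ennreal (C * Lp_norm q f)"
proof (cases "q = 1")
  case True
  show ?thesis
  proof (rule that[of 1])
    fix c :: "real ^ 'n" and f :: "real ^ 'n \<Rightarrow> real"
    assume f: "f \<in> Lp_space q"
    have "(\<integral>\<^sup>+y. ennreal (\<bar>f y\<bar> * (indicator {1..} (norm (y - c)) / norm (y - c) ^ (CARD('n) - 1))) \<partial>lebesgue)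
       \<le> (\<integral>\<^sup>+y. ennreal (\<bar>f y\<bar> powr q) \<partial>lebesgue)"
    proof (intro nn_integral_mono ennreal_leI)
      fix y :: "real ^ 'n"
      have "indicator {1..} (norm (y - c)) / norm (y - c) ^ (CARD('n) - 1) \<le> (1 :: real)"
        by (auto simp: indicator_def divide_le_eq intro: one_le_power)
      from mult_left_mono[OF this, of "\<bar>f y\<bar>"]
      show "\<bar>f y\<bar> * (indicator {1..} (norm (y - c)) / norm (y - c) ^ (CARD('n) - 1)) \<le> \<bar>f y\<bar> powr q"
        using True by simp
    qed
    also have "\<dots> = ennreal (LINT y|lebesgue. \<bar>f y\<bar> powr q)"
      using f by (intro nn_integral_eq_integral) (auto simp: Lp_space_def)
    also have "(LINT y|lebesgue. \<bar>f y\<bar> powr q) = 1 * Lp_norm q f"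
      using True by (simp add: Lp_norm_def)
    finally show "(\<integral>\<^sup>+y. ennreal (\<bar>f y\<bar> * (indicator {1..} (norm (y - c)) / norm (y - c) ^ (CARD('n) - 1))) \<partial>lebesgue)
       \<le> ennreal (1 * Lp_norm q f)" .
  qed simp
next
  case False
  define N where "N = real CARD('n)"
  define q' where "q' = q / (q - 1)"
  define k where "k = N * unit_ball_vol N"
  define e where "e = N - 1 - real (CARD('n) - 1) * q'"
  have N: "N \<ge> 3" using n by (simp add: N_def)
  have q1: "q > 1" using q False by simp
  have q': "q' > 1" "1 / q + 1 / q' = 1" using q1 by (simp_all add: q'_def field_simps)
  have "e = - ((N - 1) / (q - 1))"
    using n q1 by (simp add: e_def q'_def N_def of_nat_diff field_simps)
  then have e: "e < - 1" using q q1 by (simp add: N_def)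
  have K: "((\<lambda>r. r powr e) has_integral (- 1 / (e + 1))) {1..}"
    using has_integral_powr_to_inf[OF e, of 1] by simp
  show ?thesis
  proof (rule that[of "(k * (- 1 / (e + 1))) powr (1 / q')"])
    fix c :: "real ^ 'n" and f :: "real ^ 'n \<Rightarrow> real"
    assume f: "f \<in> Lp_space q"
    show "(\<integral>\<^sup>+y. ennreal (\<bar>f y\<bar> * (indicator {1..} (norm (y - c)) / norm (y - c) ^ (CARD('n) - 1))) \<partial>lebesgue)
       \<le> ennreal ((k * (- 1 / (e + 1))) powr (1 / q') * Lp_norm q f)"
      unfolding k_def N_def
      by (rule nn_integral_radial_kernel_Hoelder[OF _ _ _ _ f])
         (use n q1 q' K in \<open>auto simp: N_def e_def\<close>)
  qed simp
qed

section \<open>Differences of the kernel\<close>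

text \<open>
  A mean value estimate: \<open>u - w\<close> has at least half the length of \<open>u\<close>, so both reciprocals lie in
  \<open>[0, 2 / |u|]\<close>, where the \<open>m\<close>-th power has Lipschitz constant \<open>m (2 / |u|)^(m - 1)\<close>.
\<close>

lemma inverse_power_diff_le:
  fixes u w :: "'a::real_normed_vector"
  assumes "u \<noteq> 0" "2 * norm w \<le> norm u"
  shows "\<bar>1 / norm u ^ m - 1 / norm (u - w) ^ m\<bar> \<le> real m * 2 ^ m * norm w / norm u ^ (m + 1)"
proof (cases m)
  case (Suc k)
  \<comment> \<open>Dividing by \<open>2 s\<close> below brings both bases into the unit ball, where powers are
      \<open>m\<close>-Lipschitz.\<close>
  define s where "s = 1 / norm u"
  define t where "t = 1 / norm (u - w)"
  have u0: "norm u > 0" using assms by simp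
  have b: "norm u / 2 \<le> norm (u - w)" using norm_triangle_ineq2[of u w] assms by linarith
  have t0: "norm (u - w) > 0" using b u0 by linarith
  have s0: "s > 0" using u0 by (simp add: s_def)
  have st: "0 \<le> s" "0 \<le> t" "s \<le> 2 * s" "t \<le> 2 * s"
    using u0 t0 b by (auto simp: s_def t_def field_simps)
  have "\<bar>norm (u - w) - norm u\<bar> \<le> norm w" using norm_triangle_ineq3[of "u - w" u] by simp
  then have "\<bar>norm (u - w) - norm u\<bar> * (s * t) \<le> norm w * (s * t)"
    using st by (intro mult_right_mono) auto
  moreover have "s - t = (norm (u - w) - norm u) * (s * t)"
    using u0 t0 by (simp add: s_def t_def field_simps)
  ultimately have "\<bar>s - t\<bar> \<le> norm w * (s * t)" using st by (simp add: abs_mult)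
  also have "\<dots> \<le> norm w * (s * (2 * s))" using st by (intro mult_left_mono) auto
  finally have d: "\<bar>s - t\<bar> \<le> 2 * norm w * s ^ 2" by (simp add: power2_eq_square)
  have "norm ((s / (2 * s)) ^ m - (t / (2 * s)) ^ m) \<le> real m * norm (s / (2 * s) - t / (2 * s))"
    using st s0 by (intro norm_power_diff) auto
  then have "(2 * s) ^ m * norm ((s / (2 * s)) ^ m - (t / (2 * s)) ^ m)
      \<le> (2 * s) ^ m * (real m * norm (s / (2 * s) - t / (2 * s)))"
    using s0 by (intro mult_left_mono) auto
  also have "(2 * s) ^ m * norm ((s / (2 * s)) ^ m - (t / (2 * s)) ^ m)
      = norm ((2 * s * (s / (2 * s))) ^ m - (2 * s * (t / (2 * s))) ^ m)"
    using s0 by (simp only: power_mult_distrib right_diff_distrib[symmetric] norm_mult) simp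
  also have "\<dots> = norm (s ^ m - t ^ m)"
    using s0 by simp
  also have "norm (s / (2 * s) - t / (2 * s)) = norm (s - t) / (2 * s)"
    using s0 by (simp only: diff_divide_distrib[symmetric] norm_divide) simp
  also have "(2 * s) ^ m * (real m * (norm (s - t) / (2 * s))) = norm (s - t) * (real m * (2 * s) ^ (m - 1))"
    using s0 by (simp add: Suc)
  finally have "norm (s ^ m - t ^ m) \<le> norm (s - t) * (real m * (2 * s) ^ (m - 1))" .
  also have "\<dots> \<le> (2 * norm w * s ^ 2) * (real m * (2 * s) ^ (m - 1))"
    using d st by (intro mult_right_mono) auto
  also have "\<dots> = real m * 2 ^ m * norm w * s ^ (m + 1)"
    by (simp add: Suc power_mult_distrib power2_eq_square)
  finally show ?thesis by (simp add: s_def t_def power_one_over)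
qed auto


text \<open>
  The ranges are written as indicators so that the bound is a sum of the kernels estimated above.
  The ball around \<open>z\<close> has radius \<open>3h\<close> because it must contain the ball of radius \<open>2h\<close> around \<open>x\<close>.  The
  outer cutoff \<open>R\<close> is kept apart from \<open>1\<close> because for \<open>2h > 1\<close> the annulus from \<open>2h\<close> to \<open>1\<close>
  would be empty; taking \<open>R\<close> as the larger of \<open>1\<close> and \<open>2h\<close> makes it at worst degenerate.
\<close>

lemma kernel_difference_le:
  fixes x y z :: "'a::real_normed_vector" and R :: real
  assumes xz: "x \<noteq> z" and R: "R \<ge> 1"
  defines "h \<equiv> norm (x - z)"
  shows "\<bar>1 / norm (y - x) ^ m - 1 / norm (y - z) ^ m\<bar> \<le>
      indicator {0..2 * h} (norm (y - x)) / norm (y - x) ^ m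
    + indicator {0..3 * h} (norm (y - z)) / norm (y - z) ^ m
    + real m * 2 ^ m * h * (indicator {2 * h..R} (norm (y - x)) / norm (y - x) ^ (m + 1)
                          + indicator {1..} (norm (y - x)) / norm (y - x) ^ (m + 1))"
    (is "?d \<le> ?A + ?B + ?c * (?D + ?E)")
proof (cases "norm (y - x) \<le> 2 * h")
  case True
  have "norm (y - z) \<le> norm (y - x) + h"
    using norm_triangle_ineq[of "y - x" "x - z"] by (simp add: h_def)
  with True have "?A = 1 / norm (y - x) ^ m" "?B = 1 / norm (y - z) ^ m" by auto
  moreover have "?d \<le> 1 / norm (y - x) ^ m + 1 / norm (y - z) ^ m"
    using abs_triangle_ineq4[of "1 / norm (y - x) ^ m" "1 / norm (y - z) ^ m"] by simp
  moreover have "0 \<le> ?c * (?D + ?E)"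
    by (intro mult_nonneg_nonneg add_nonneg_nonneg) (auto simp: h_def)
  ultimately show ?thesis by linarith
next
  case False
  have h: "h > 0" using xz by (simp add: h_def)
  have "norm (y - x) > 0" using False h by linarith
  then have "?d \<le> real m * 2 ^ m * norm (z - x) / norm (y - x) ^ (m + 1)"
    using False inverse_power_diff_le[of "y - x" "z - x" m] by (simp add: h_def norm_minus_commute)
  also have "\<dots> = ?c * (1 / norm (y - x) ^ (m + 1))"
    by (simp add: h_def norm_minus_commute)
  also have "\<dots> \<le> ?c * (?D + ?E)"
    using False R h by (intro mult_left_mono) (auto simp: indicator_def)
  finally have "?d \<le> ?c * (?D + ?E)" .
  moreover have "?A \<ge> 0" "?B \<ge> 0" by auto
  ultimately show ?thesis by linarith
qed

text \<open>
  Integrability is part of the claim because it is needed for the base point \<open>z = 0\<close>, which occurs in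
  the definition of the potential, before integrals for different points may be subtracted.
\<close>

lemma kernel_difference_integral:
  assumes n: "CARD('n::finite) \<ge> 3" and q: "1 \<le> q" "q < real CARD('n)"
  shows "\<exists>C. \<forall>x z :: real ^ 'n. \<forall>f \<in> Lp_space (real CARD('n)) \<inter> Lp_space q.
     integrable lebesgue (\<lambda>y. (1 / norm (y - x) ^ (CARD('n) - 2) - 1 / norm (y - z) ^ (CARD('n) - 2)) * f y) \<and>
     \<bar>LINT y|lebesgue. (1 / norm (y - x) ^ (CARD('n) - 2) - 1 / norm (y - z) ^ (CARD('n) - 2)) * f y\<bar>
       \<le> C * norm (x - z) * (\<bar>ln (norm (x - z))\<bar> + 1) powr (1 / hoelder_conj (real CARD('n)))
           * (Lp_norm q f + Lp_norm (real CARD('n)) f)"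
proof -
  define N where "N = real CARD('n)"
  define m where "m = CARD('n) - 2"
  define s where "s = 1 / hoelder_conj N"
  have m: "CARD('n) - 1 = m + 1" using n by (simp add: m_def)
  have s: "s \<ge> 0" using n by (simp add: s_def N_def hoelder_conj_def)
  obtain Ci where Ci: "Ci \<ge> 0" and inner: "\<And>\<rho> (c :: real ^ 'n) f. \<rho> \<ge> 0 \<Longrightarrow> f \<in> Lp_space N \<Longrightarrow>
     (\<integral>\<^sup>+y. ennreal (\<bar>f y\<bar> * (indicator {0..\<rho>} (norm (y - c)) / norm (y - c) ^ m)) \<partial>lebesgue)
       \<le> ennreal (Ci * \<rho> * Lp_norm N f)"
    using inner_kernel_bound[OF n, folded m_def N_def] by blast
  obtain Ca where Ca: "Ca \<ge> 0" and annulus: "\<And>a b (c :: real ^ 'n) f. a > 0 \<Longrightarrow> a \<le> b \<Longrightarrow> f \<in> Lp_space N \<Longrightarrow>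
     (\<integral>\<^sup>+y. ennreal (\<bar>f y\<bar> * (indicator {a..b} (norm (y - c)) / norm (y - c) ^ (m + 1))) \<partial>lebesgue)
       \<le> ennreal (Ca * ln (b / a) powr s * Lp_norm N f)"
    using annular_kernel_bound[OF n, folded N_def, folded s_def, unfolded m] by blast
  obtain Co where Co: "Co \<ge> 0" and outer: "\<And>(c :: real ^ 'n) f. f \<in> Lp_space q \<Longrightarrow>
     (\<integral>\<^sup>+y. ennreal (\<bar>f y\<bar> * (indicator {1..} (norm (y - c)) / norm (y - c) ^ (m + 1))) \<partial>lebesgue)
       \<le> ennreal (Co * Lp_norm q f)"
    using outer_kernel_bound[OF n q, unfolded m] by blast
  define c0 where "c0 = real m * 2 ^ m"
  define C where "C = 5 * Ci + c0 * Ca + c0 * Co"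
  have c0: "c0 \<ge> 0" by (simp add: c0_def)
  have C: "C \<ge> 0" using Ci Ca Co c0 by (simp add: C_def)
  have main: "integrable lebesgue (\<lambda>y. (1 / norm (y - x) ^ m - 1 / norm (y - z) ^ m) * f y) \<and>
     \<bar>LINT y|lebesgue. (1 / norm (y - x) ^ m - 1 / norm (y - z) ^ m) * f y\<bar>
       \<le> C * norm (x - z) * (\<bar>ln (norm (x - z))\<bar> + 1) powr s * (Lp_norm q f + Lp_norm N f)"
    if f: "f \<in> Lp_space N" "f \<in> Lp_space q" for x z :: "real ^ 'n" and f
  proof (cases "x = z")
    case True
    then show ?thesis by simp
  next
    case False
    define h where "h = norm (x - z)"
    define R where "R = max 1 (2 * h)"
    define \<Lambda> where "\<Lambda> = (\<bar>ln h\<bar> + 1) powr s"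
    define G where "G = (\<lambda>y. (1 / norm (y - x) ^ m - 1 / norm (y - z) ^ m) * f y)"
    define g where "g = (\<lambda>S c j y. \<bar>f y\<bar> * (indicator S (norm (y - c)) / norm (y - c) ^ j))"
    define \<phi> \<psi> where "\<phi> = Lp_norm N f" and "\<psi> = Lp_norm q f"
    have \<phi>\<psi>: "\<phi> \<ge> 0" "\<psi> \<ge> 0" by (simp_all add: \<phi>_def \<psi>_def Lp_norm_def)
    have h: "h > 0" using False by (simp add: h_def)
    have R: "R \<ge> 1" "R \<ge> 2 * h" by (simp_all add: R_def)
    have \<Lambda>: "\<Lambda> \<ge> 1" using s by (simp add: \<Lambda>_def ge_one_powr_ge_zero)
    \<comment> \<open>For \<open>2 h \<ge> 1\<close> the annulus degenerates and the logarithm is zero.\<close>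
    have "ln (R / (2 * h)) \<le> \<bar>ln h\<bar> + 1"
      using h by (auto simp: R_def max_def ln_div ln_mult intro: order.trans[of _ 0])
    moreover have "ln (R / (2 * h)) \<ge> 0" using R h by simp
    ultimately have log: "ln (R / (2 * h)) powr s \<le> \<Lambda>"
      unfolding \<Lambda>_def using s by (intro powr_mono2) auto
    have [measurable]: "f \<in> borel_measurable lebesgue" using f by (simp add: Lp_space_def)
    have ker: "(\<lambda>y. indicator S (norm (y - c)) / norm (y - c) ^ j :: real) \<in> borel_measurable lebesgue"
      if [measurable]: "S \<in> sets borel" for S and c :: "real ^ 'n" and j
      by (rule measurable_completion) measurable
    have [measurable]: "g S c j \<in> borel_measurable lebesgue" if "S \<in> sets borel" for S c j
      unfolding g_def using ker[OF that, of c j] by measurable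
    have g0: "g S c j y \<ge> 0" for S c j y by (simp add: g_def)
    have "(\<lambda>y :: real ^ 'n. 1 / norm (y - x) ^ m - 1 / norm (y - z) ^ m) \<in> borel_measurable lebesgue"
      by (rule measurable_completion) measurable
    then have [measurable]: "G \<in> borel_measurable lebesgue" unfolding G_def by measurable
    have norm_G: "norm (G y) = \<bar>f y\<bar> * \<bar>1 / norm (y - x) ^ m - 1 / norm (y - z) ^ m\<bar>" for y
      by (simp add: G_def abs_mult mult.commute)
    have pt: "norm (G y) \<le> g {0..2 * h} x m y + g {0..3 * h} z m y
         + c0 * h * (g {2 * h..R} x (m + 1) y + g {1..} x (m + 1) y)" for y
      using mult_left_mono[OF kernel_difference_le[OF False R(1), of y m], of "\<bar>f y\<bar>"]
      unfolding norm_G g_def c0_def h_def by (simp add: algebra_simps)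
    have "(\<integral>\<^sup>+y. ennreal (norm (G y)) \<partial>lebesgue) \<le>
        (\<integral>\<^sup>+y. ennreal (g {0..2 * h} x m y) + ennreal (g {0..3 * h} z m y)
         + ennreal (c0 * h) * (ennreal (g {2 * h..R} x (m + 1) y) + ennreal (g {1..} x (m + 1) y)) \<partial>lebesgue)"
      using pt g0 c0 h by (intro nn_integral_mono)
        (simp add: ennreal_mult'[symmetric] ennreal_plus[symmetric] ennreal_leI del: ennreal_plus)
    also have "\<dots> = (\<integral>\<^sup>+y. ennreal (g {0..2 * h} x m y) \<partial>lebesgue) + (\<integral>\<^sup>+y. ennreal (g {0..3 * h} z m y) \<partial>lebesgue)
         + ennreal (c0 * h) * ((\<integral>\<^sup>+y. ennreal (g {2 * h..R} x (m + 1) y) \<partial>lebesgue)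
                             + (\<integral>\<^sup>+y. ennreal (g {1..} x (m + 1) y) \<partial>lebesgue))"
      by (simp add: nn_integral_add nn_integral_cmult)
    also have "\<dots> \<le> ennreal (Ci * (2 * h) * \<phi>) + ennreal (Ci * (3 * h) * \<phi>)
         + ennreal (c0 * h) * (ennreal (Ca * ln (R / (2 * h)) powr s * \<phi>) + ennreal (Co * \<psi>))"
      unfolding g_def \<phi>_def \<psi>_def using h R f
      by (intro add_mono mult_left_mono inner annulus outer) auto
    also have "\<dots> = ennreal (Ci * (2 * h) * \<phi> + Ci * (3 * h) * \<phi>
         + c0 * h * (Ca * ln (R / (2 * h)) powr s * \<phi> + Co * \<psi>))"
      using Ci Ca Co c0 h \<phi>\<psi>
      by (simp add: ennreal_mult'[symmetric] ennreal_plus[symmetric] del: ennreal_plus)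
    also have "\<dots> \<le> ennreal (C * h * \<Lambda> * (\<psi> + \<phi>))"
    proof (rule ennreal_leI)
      have "Ci * (2 * h) * \<phi> + Ci * (3 * h) * \<phi> + c0 * h * (Ca * ln (R / (2 * h)) powr s * \<phi> + Co * \<psi>)
          = (5 * Ci) * h * (1 * \<phi>) + (c0 * Ca) * h * (ln (R / (2 * h)) powr s * \<phi>) + (c0 * Co) * h * (1 * \<psi>)"
        by (simp add: algebra_simps)
      also have "\<dots> \<le> (5 * Ci) * h * (\<Lambda> * (\<psi> + \<phi>)) + (c0 * Ca) * h * (\<Lambda> * (\<psi> + \<phi>)) + (c0 * Co) * h * (\<Lambda> * (\<psi> + \<phi>))"
        using Ci Ca Co c0 h \<phi>\<psi> \<Lambda> log by (intro add_mono mult_left_mono mult_mono) auto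
      finally show "Ci * (2 * h) * \<phi> + Ci * (3 * h) * \<phi> + c0 * h * (Ca * ln (R / (2 * h)) powr s * \<phi> + Co * \<psi>)
          \<le> C * h * \<Lambda> * (\<psi> + \<phi>)"
        by (simp add: C_def algebra_simps)
    qed
    finally have bound: "(\<integral>\<^sup>+y. ennreal (norm (G y)) \<partial>lebesgue) \<le> ennreal (C * h * \<Lambda> * (\<psi> + \<phi>))" .
    then have int: "integrable lebesgue G"
      by (intro integrableI_bounded) (auto intro: le_less_trans)
    have "ennreal (norm (integral\<^sup>L lebesgue G)) \<le> (\<integral>\<^sup>+y. ennreal (norm (G y)) \<partial>lebesgue)"
      using int by (rule integral_norm_bound_ennreal)
    then have "norm (integral\<^sup>L lebesgue G) \<le> C * h * \<Lambda> * (\<psi> + \<phi>)"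
      using bound C h \<Lambda> \<phi>\<psi> by (simp flip: ennreal_le_iff)
    with int show ?thesis by (simp add: G_def h_def \<Lambda>_def \<phi>_def \<psi>_def)
  qed
  show ?thesis
    using main unfolding m_def N_def s_def by (intro exI[of _ C]) blast
qed

section \<open>Log-Lipschitz estimate for the renormalised potential\<close>

theorem theorem1p3:
  fixes q :: real
  assumes "CARD('n::finite) \<ge> 3"
    and "1 \<le> q" and "q < real CARD('n)"
  shows "\<exists>C::real. \<forall>x z :: real ^ 'n.
           \<forall>f \<in> Lp_space (real CARD('n)) \<inter> Lp_space q.
             \<bar>I2_tilde f x - I2_tilde f z\<bar>
               \<le> C * norm (x - z)
                   * (\<bar>ln (norm (x - z))\<bar> + 1) powr (1 / hoelder_conj (real CARD('n)))
                   * (Lp_norm q f + Lp_norm (real CARD('n)) f)"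
proof -
  define c where "c = Gamma (real CARD('n) / 2) / (2 * pi powr (real CARD('n) / 2) * (real CARD('n) - 2))"
  define K :: "(real ^ 'n \<Rightarrow> real) \<Rightarrow> real ^ 'n \<Rightarrow> real ^ 'n \<Rightarrow> real ^ 'n \<Rightarrow> real" where
    "K f x z y = (1 / norm (y - x) ^ (CARD('n) - 2) - 1 / norm (y - z) ^ (CARD('n) - 2)) * f y" for f x z y
  define B where "B x z f = norm (x - z) * (\<bar>ln (norm (x - z))\<bar> + 1) powr (1 / hoelder_conj (real CARD('n)))
                   * (Lp_norm q f + Lp_norm (real CARD('n)) f)" for x z :: "real ^ 'n" and f :: "real ^ 'n \<Rightarrow> real"
  have K: "K f x z = (\<lambda>y. (1 / norm (y - x) ^ (CARD('n) - 2) - 1 / norm (y - z) ^ (CARD('n) - 2)) * f y)"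
    for f x z by (simp add: K_def fun_eq_iff)
  obtain C where int_C: "\<And>x z f. f \<in> Lp_space (real CARD('n)) \<inter> Lp_space q \<Longrightarrow>
      integrable lebesgue (K f x z) \<and> \<bar>integral\<^sup>L lebesgue (K f x z)\<bar> \<le> C * B x z f"
    using kernel_difference_integral[OF assms] unfolding K B_def mult.assoc by blast
  note int = int_C[THEN conjunct1] and C = int_C[THEN conjunct2]
  have "\<bar>I2_tilde f x - I2_tilde f z\<bar> \<le> (\<bar>c\<bar> * C) * B x z f"
    if f: "f \<in> Lp_space (real CARD('n)) \<inter> Lp_space q" for x z :: "real ^ 'n" and f
  proof -
    have I: "I2_tilde f x = c * integral\<^sup>L lebesgue (K f x 0)" for x
      by (simp add: I2_tilde_def c_def K)
    have "integral\<^sup>L lebesgue (K f x 0) - integral\<^sup>L lebesgue (K f z 0)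
        = (LINT y|lebesgue. K f x 0 y - K f z 0 y)"
      using int[OF f] by simp
    also have "(\<lambda>y. K f x 0 y - K f z 0 y) = K f x z"
      by (simp add: K_def fun_eq_iff algebra_simps)
    finally have "I2_tilde f x - I2_tilde f z = c * integral\<^sup>L lebesgue (K f x z)"
      by (simp add: I right_diff_distrib[symmetric])
    then show ?thesis
      using mult_left_mono[OF C[OF f, of x z], of "\<bar>c\<bar>"] by (simp add: abs_mult mult.assoc)
  qed
  then show ?thesis unfolding B_def by (intro exI[of _ "\<bar>c\<bar> * C"]) (simp add: mult.assoc)
qed

end
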